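(* Let $a_1,\ldots,a_m\in\mathbb R^n$ be such that the set $\{\operatorname{sgn}a_i\mid i\in[m]\}$ is consistent, and let $y\in\mathbb R^m$. If $$\max_{i\mid a_{ij}<0}y_i=\max_{i\mid a_{ij}>0}y_i$$ holds for every $j\in[n]$, then the set $\{\operatorname{sgn}a_i\mid i\in\operatorname{argmax}y\}$ is consistent.
   Context: Let $m,n\ge1$, $[m]=\{1,\ldots,m\}$, $a_i=(a_{i1},\ldots,a_{in})\in\mathbb R^n$. For $a\in\mathbb R^n$, $\operatorname{sgn}a\in\{-1,0,1\}^n$ is taken componentwise. For $y\in\mathbb R^m$, $\max y=\max_{i\in[m]}y_i$ and $\operatorname{argmax}y=\{i\in[m]\mid y_i=\max y\}$. The maximum over an empty index set is $-\infty$ (so the displayed equality holds trivially for $j$ with $a_{ij}=0$ for all $i$). A set $S\subseteq\{-1,0,1\}^n$ is consistent in coordinate $j\in[n]$ if ($\exists s\in S$: $s_j=-1$) $\Leftrightarrow$ ($\exists t\in S$: $t_j=1$); $S$ is consistent if it is consistent in every coordinate $j\in[n]$. *)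

theory Defs
  imports "HOL-Analysis.Finite_Cartesian_Product" "HOL-Library.Extended_Real"
begin

text \<open>
  Index sets are finite types: a family of \<open>m\<close> vectors in \<open>n\<close>-dimensional real space is a function
  \<^typ>\<open>'m::finite \<Rightarrow> real ^ 'n::finite\<close>; types being nonempty, both numbers are at least 1.
  The library's \<^const>\<open>sgn\<close> on vectors is normalisation by the norm, so the componentwise sign is
  defined separately.
\<close>

definition sgn_vec :: "real ^ 'n \<Rightarrow> real ^ 'n" where
  "sgn_vec a = (\<chi> j. sgn (a $ j))"

definition consistent_in :: "(real ^ 'n) set \<Rightarrow> 'n \<Rightarrow> bool" where
  "consistent_in S j \<longleftrightarrow> ((\<exists>s\<in>S. s $ j = - 1) \<longleftrightarrow> (\<exists>t\<in>S. t $ j = 1))"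

definition consistent :: "(real ^ 'n) set \<Rightarrow> bool" where
  "consistent S \<longleftrightarrow> (\<forall>j. consistent_in S j)"

definition max_over :: "'m::finite set \<Rightarrow> real ^ 'm \<Rightarrow> ereal" where
  "max_over I y = (if I = {} then - \<infinity> else ereal (Max ((\<lambda>i. y $ i) ` I)))"

definition argmax :: "real ^ 'm \<Rightarrow> 'm::finite set" where
  "argmax y = {i. y $ i = Max (range (\<lambda>k. y $ k))}"

end

theory Submission
  imports Defs
begin

text \<open>A set of indices meets \<open>argmax y\<close> exactly when the maximum of
  \<open>y\<close> over it is the global maximum (\<open>argmax_meets_iff_max_over\<close>). For
  each \<open>j\<close>, the negative and positive index sets have equal maxima, so
  \<open>argmax y\<close> meets both or neither, which is consistency in \<open>j\<close>.\<close>

lemma argmax_meets_iff_max_over: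
  fixes y :: "real ^ 'm::finite"
  shows "(\<exists>i\<in>argmax y. i \<in> I) \<longleftrightarrow> max_over I y = ereal (Max (range (\<lambda>k. y $ k)))"
proof (cases "I = {}")
  case True
  \<comment> \<open>Both sides are false: the value -\<infinity> differs from every real.\<close>
  then show ?thesis by (simp add: max_over_def)
next
  case False
  let ?M = "Max (range (\<lambda>k. y $ k))"
  \<comment> \<open>\<open>?M\<close> already bounds \<open>y\<close> on all of \<open>I\<close>, so
    only attainment is at stake.\<close>
  have "Max ((\<lambda>i. y $ i) ` I) = ?M \<longleftrightarrow> ?M \<in> (\<lambda>i. y $ i) ` I"
    using False by (subst Max_eq_iff) auto
  moreover have "?M \<in> (\<lambda>i. y $ i) ` I \<longleftrightarrow> (\<exists>i\<in>argmax y. i \<in> I)"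
    unfolding argmax_def image_iff mem_Collect_eq Bex_def by metis
  ultimately show ?thesis
    using False by (simp add: max_over_def)
qed

theorem theorem9:
  fixes a :: "'m::finite \<Rightarrow> real ^ 'n::finite"
    and y :: "real ^ 'm"
  assumes "consistent (range (\<lambda>i. sgn_vec (a i)))"
    and "\<And>j. max_over {i. a i $ j < 0} y = max_over {i. a i $ j > 0} y"
  shows "consistent ((\<lambda>i. sgn_vec (a i)) ` argmax y)"
proof -
  \<comment> \<open>Each side says that the common value of the two maxima is the global
    maximum.\<close>
  have "(\<exists>i\<in>argmax y. a i $ j < 0) \<longleftrightarrow> (\<exists>i\<in>argmax y. a i $ j > 0)" for j
    using argmax_meets_iff_max_over[of y "{i. a i $ j < 0}"]
      argmax_meets_iff_max_over[of y "{i. a i $ j > 0}"] assms(2)[of j]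
    by simp
  then show ?thesis
    by (simp add: consistent_def consistent_in_def sgn_vec_def sgn_1_neg sgn_1_pos)
qed

end
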